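(* Let $f:\mathbb{Z}\to\mathbb{Z}$ be a bi-Lipschitz bijection, where $\mathbb{Z}$ is equipped with its usual metric $\rho(x,y)=|x-y|$. Then either $$\sup_{x\in\mathbb{Z}}|f(x)-x|<+\infty \quad\text{or}\quad \sup_{x\in\mathbb{Z}}|f(x)+x|<+\infty.$$ More precisely, there exist a sign $\varepsilon\in\{+1,-1\}$ and a constant $c\in\mathbb{R}$ (both independent of $x$) such that, for all $x\in\mathbb{Z}$, $$f(x)=\varepsilon x+c+r(x),\qquad |r(x)|\le \|f\|_{\mathrm{Lip}}\,\|f^{-1}\|_{\mathrm{Lip}}.$$
   Context: A bi-Lipschitz bijection between metric spaces $(X,\rho_X)$ and $(Y,\rho_Y)$ is a bijective map $f:X\to Y$ for which there are constants $0<C_1\le C_2<+\infty$ such that for all $x_1,x_2\in X$, $C_1\rho_X(x_1,x_2)\le\rho_Y(f(x_1),f(x_2))\le C_2\rho_X(x_1,x_2)$. The Lipschitz constant of a map $f:X\to Y$ is $\|f\|_{\mathrm{Lip}}:=\sup_{x_1\ne x_2}\frac{\rho_Y(f(x_1),f(x_2))}{\rho_X(x_1,x_2)}$. Thus a bijection $f$ is bi-Lipschitz if and only if both $\|f\|_{\mathrm{Lip}}$ and $\|f^{-1}\|_{\mathrm{Lip}}$ are finite. *)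

theory Defs
  imports "HOL-Analysis.Analysis"
begin

definition bi_lipschitz_bijection :: "'a metric \<Rightarrow> 'b metric \<Rightarrow> ('a \<Rightarrow> 'b) \<Rightarrow> bool" where
  "bi_lipschitz_bijection m1 m2 f \<longleftrightarrow> bij_betw f (mspace m1) (mspace m2) \<and>
     (\<exists>C1 C2::real. 0 < C1 \<and> C1 \<le> C2 \<and>
       (\<forall>x\<in>mspace m1. \<forall>y\<in>mspace m1.
          C1 * mdist m1 x y \<le> mdist m2 (f x) (f y) \<and>
          mdist m2 (f x) (f y) \<le> C2 * mdist m1 x y))"

(* Taken in the extended nonnegative reals, so the supremum is infinity for maps that are not
   Lipschitz and 0 on a one-point space. *)
definition lipschitz_const :: "'a metric \<Rightarrow> 'b metric \<Rightarrow> ('a \<Rightarrow> 'b) \<Rightarrow> ennreal" where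
  "lipschitz_const m1 m2 f =
     (SUP (x, y) \<in> {(x, y). x \<in> mspace m1 \<and> y \<in> mspace m1 \<and> x \<noteq> y}.
        ennreal (mdist m2 (f x) (f y) / mdist m1 x y))"

(* The library has no instance int :: metric_space, hence the explicit metric. *)
definition int_metric :: "int metric" where
  "int_metric = metric (UNIV, \<lambda>x y. real_of_int \<bar>x - y\<bar>)"

lemma Metric_space_int: "Metric_space UNIV (\<lambda>x y::int. real_of_int \<bar>x - y\<bar>)"
  by unfold_locales auto

lemma mspace_int_metric [simp]: "mspace int_metric = UNIV"
  unfolding int_metric_def by (rule Metric_space.mspace_metric [OF Metric_space_int])

lemma mdist_int_metric [simp]: "mdist int_metric x y = real_of_int \<bar>x - y\<bar>"
  unfolding int_metric_def Metric_space.mdist_metric [OF Metric_space_int] by (rule refl)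

end

theory Submission
  imports Defs
begin

text \<open>
  Let \<open>L\<close> and \<open>M\<close> be the Lipschitz constants of \<open>f\<close> and of its inverse \<open>g\<close>.  An injective map
  of the integers with bounded steps leaves the window \<open>{-L..L}\<close> for good in each direction and
  can then no longer change sign, and by surjectivity the signs at the two ends differ; after
  replacing \<open>f\<close> by \<open>-f\<close> if necessary, \<open>f\<close> fixes both ends of the line.  Then the half-line
  \<open>{..n}\<close> and the preimage \<open>{x. f x \<le> m}\<close> of a half-line differ by finitely many points, so
  the difference between the number of points in the first set only and in the second set only
  makes sense (\<open>excess\<close>).  Raising \<open>n\<close> by one adds one to this number, and raising \<open>m\<close> by one
  subtracts one, so it equals \<open>n - m + c\<close> for a constant \<open>c\<close>: this is the translation part of \<open>f\<close>.

  For \<open>m = n + c\<close> the two sets balance: as many points cross from the left of \<open>n\<close> to above \<open>m\<close>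
  as from the right of \<open>n\<close> to below.  Suppose that \<open>f n\<close> lies at distance \<open>K\<close> above \<open>m\<close>.
  All points at distance less than \<open>K / L\<close> from \<open>n\<close> are still sent above \<open>m\<close>, so that \<open>g\<close>
  restricted to \<open>{..m}\<close> avoids a window around \<open>n\<close>.  By balance some value of this restriction
  is to the right of the window, while almost all of them are to the left.  Hence some step
  of \<open>g\<close> jumps over the window, which forces \<open>2 * K / L \<le> M\<close>
  (\<open>overshoot_bound\<close>).  Reflecting the line gives the bound from below.
  The argument yields half of the asserted error bound.
\<close>

section \<open>Excess of one set over another\<close>

definition commensurate :: "'a set \<Rightarrow> 'a set \<Rightarrow> bool" where
  "commensurate A B \<longleftrightarrow> finite (A - B) \<and> finite (B - A)"

definition excess :: "'a set \<Rightarrow> 'a set \<Rightarrow> int" where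
  "excess A B = int (card (A - B)) - int (card (B - A))"

lemma commensurate_commute: "commensurate A B \<longleftrightarrow> commensurate B A"
  by (auto simp: commensurate_def)

lemma excess_swap: "excess A B = - excess B A"
  by (simp add: excess_def)

lemma commensurate_insert_left: "commensurate (insert a A) B \<longleftrightarrow> commensurate A B"
proof -
  have "B - A \<subseteq> insert a (B - insert a A)"
    by blast
  then have "finite (B - insert a A) \<longleftrightarrow> finite (B - A)"
    by (meson Diff_mono finite.insertI finite_subset order_refl subset_insertI)
  then show ?thesis
    by (auto simp: commensurate_def insert_Diff_if)
qed

lemma commensurate_insert_right: "commensurate A (insert b B) \<longleftrightarrow> commensurate A B"
  using commensurate_insert_left commensurate_commute by metis

lemma excess_insert_left:
  assumes "commensurate A B" "a \<notin> A"
  shows "excess (insert a A) B = excess A B + 1"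
proof (cases "a \<in> B")
  case True
  have "B - A = insert a (B - insert a A)"
    using True assms(2) by blast
  moreover have "finite (B - insert a A)"
    using assms(1) by (auto simp: commensurate_def intro: finite_subset[of _ "B - A"])
  ultimately have "card (B - A) = Suc (card (B - insert a A))"
    by (metis card_insert_disjoint DiffD2 insertI1)
  moreover have "insert a A - B = A - B"
    using True by blast
  ultimately show ?thesis
    by (simp add: excess_def)
next
  case False
  then have "insert a A - B = insert a (A - B)" "B - insert a A = B - A"
    by blast+
  then show ?thesis
    using assms by (simp add: excess_def commensurate_def)
qed

lemma excess_insert_right:
  assumes "commensurate A B" "b \<notin> B"
  shows "excess A (insert b B) = excess A B - 1"
  using excess_insert_left[of B A b] assms commensurate_commute[of A B]
    excess_swap[of A B] excess_swap[of A "insert b B"] by simp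

section \<open>Integer sequences with bounded steps\<close>

lemma dist_le_of_step_le:
  fixes h :: "int \<Rightarrow> int"
  assumes step: "\<And>x. \<bar>h (x + 1) - h x\<bar> \<le> L"
  shows "\<bar>h x - h y\<bar> \<le> L * \<bar>x - y\<bar>"
proof -
  have ordered: "\<bar>h v - h u\<bar> \<le> L * (v - u)" if "u \<le> v" for u v
    using that
  proof (induction v rule: int_ge_induct)
    case base
    show ?case by simp
  next
    case (step i)
    then show ?case
      using assms[of i] by (simp add: algebra_simps)
  qed
  show ?thesis
    using ordered[of x y] ordered[of y x] by (cases "x \<le> y") (auto simp: abs_minus_commute)
qed

lemma stays_above_gap:
  fixes h :: "int \<Rightarrow> int"
  assumes step: "\<And>x. \<bar>h (x + 1) - h x\<bar> \<le> L"
    and gap: "\<And>x. s \<le> x \<Longrightarrow> h x \<le> a \<or> b \<le> h x"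
    and wide: "L < b - a"
    and start: "b \<le> h s"
    and "s \<le> x"
  shows "b \<le> h x"
  using \<open>s \<le> x\<close>
proof (induction x rule: int_ge_induct)
  case base
  show ?case by (fact start)
next
  case (step i)
  then show ?case
    using assms(1)[of i] gap[of "i + 1"] wide by linarith
qed

section \<open>Bijections of the integers with bounded steps\<close>

locale int_lipschitz_bijection =
  fixes f g :: "int \<Rightarrow> int" and L M :: int
  assumes g_f [simp]: "g (f x) = x"
    and f_g [simp]: "f (g y) = y"
    and step_f: "\<bar>f (x + 1) - f x\<bar> \<le> L"
    and step_g: "\<bar>g (y + 1) - g y\<bar> \<le> M"
begin

lemma inj_f: "inj f"
  by (metis g_f injI)

lemma inj_g: "inj g"
  by (metis f_g injI)

lemma L_pos: "0 < L"
proof -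
  have "f (0 + 1) \<noteq> f 0"
    using inj_f by (simp add: inj_eq)
  then show ?thesis
    using step_f[of 0] by linarith
qed

lemma uminus_image: "int_lipschitz_bijection (\<lambda>x. - f x) (\<lambda>y. g (- y)) L M"
proof
  show "\<bar>- f (x + 1) - - f x\<bar> \<le> L" for x
    using step_f[of x] by linarith
  show "\<bar>g (- (y + 1)) - g (- y)\<bar> \<le> M" for y
    using step_g[of "- y - 1"] by (simp add: abs_minus_commute)
qed auto

lemma reflect: "int_lipschitz_bijection (\<lambda>x. - f (- x)) (\<lambda>y. - g (- y)) L M"
proof
  show "\<bar>- f (- (x + 1)) - - f (- x)\<bar> \<le> L" for x
    using step_f[of "- x - 1"] by simp
  show "\<bar>- g (- (y + 1)) - - g (- y)\<bar> \<le> M" for y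
    using step_g[of "- y - 1"] by simp
qed auto

subsection \<open>Behaviour at the ends\<close>

text \<open>
  Injectivity lets \<open>f\<close> visit the window \<open>{-L..L}\<close> only finitely often, and steps of size at most
  \<open>L\<close> cannot jump across it.
\<close>
lemma eventually_constant_sign: "(\<exists>N. \<forall>x\<ge>N. 0 < f x) \<or> (\<exists>N. \<forall>x\<ge>N. f x < 0)"
proof -
  have "finite (f -` {-L..L})"
    by (rule finite_vimageI[OF _ inj_f]) simp
  then have "bdd_above (f -` {-L..L})"
    by (rule bdd_above_finite)
  then obtain B where "\<And>x. x \<in> f -` {-L..L} \<Longrightarrow> x \<le> B"
    unfolding bdd_above.unfold by blast
  then obtain N where N: "\<And>x. x \<in> f -` {-L..L} \<Longrightarrow> x < N"
    using zle_add1_eq_le by blast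
  have gap: "f x \<le> - L - 1 \<or> L + 1 \<le> f x" if "N \<le> x" for x
    using N[of x] that by force
  show ?thesis
  proof (cases "L + 1 \<le> f N")
    case True
    have "L + 1 \<le> f x" if "N \<le> x" for x
      by (rule stays_above_gap[where a = "- L - 1", OF step_f gap _ True that])
        (use L_pos in auto)
    then show ?thesis
      using L_pos by (meson add_pos_pos less_le_trans zero_less_one)
  next
    case False
    then have start: "L + 1 \<le> - f N"
      using gap[of N] by linarith
    have "L + 1 \<le> - f x" if "N \<le> x" for x
    proof (rule stays_above_gap[where h = "\<lambda>x. - f x" and a = "- L - 1", OF _ _ _ start that])
      show "\<bar>- f (x + 1) - - f x\<bar> \<le> L" for x
        using step_f[of x] by linarith
      show "- f x \<le> - L - 1 \<or> L + 1 \<le> - f x" if "N \<le> x" for x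
        using gap[OF that] by linarith
    qed (use L_pos in auto)
    then have "\<forall>x\<ge>N. f x < 0"
      using L_pos by force
    then show ?thesis
      by blast
  qed
qed

lemma not_positive_at_both_ends:
  assumes "\<And>x. N \<le> x \<Longrightarrow> 0 < f x" "\<And>x. x \<le> N' \<Longrightarrow> 0 < f x"
  shows False
proof -
  have "g ` {..0} \<subseteq> {N'..N}"
  proof
    fix x assume "x \<in> g ` {..0}"
    then have "f x \<le> 0" by auto
    then show "x \<in> {N'..N}"
      using assms(1)[of x] assms(2)[of x] by force
  qed
  then have "finite (g ` {..0})"
    by (rule finite_subset) simp
  then show False
    using finite_imageD[OF _ inj_on_subset[OF inj_g subset_UNIV]] infinite_Iic by blast
qed

text \<open>
  A common sign at both ends would leave only finitely many points to cover the infinitely many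
  values of the other sign.  So \<open>f\<close> fixes the two ends of the line, or swaps them and \<open>-f\<close> fixes
  them; fixing the ends is what makes the two half-lines commensurate.
\<close>
lemma commensurate_up_to_sign:
  "commensurate {..0} {x. f x \<le> 0} \<or> commensurate {..0} {x. - f x \<le> 0}"
proof -
  have fixes_ends: "commensurate {..0} {x. h x \<le> 0}"
    if "\<forall>x\<ge>N. 0 < h x" "\<forall>x\<le>N'. h x < 0" for h :: "int \<Rightarrow> int" and N N'
  proof -
    have "N' \<le> x" if "0 < h x" for x
      using that \<open>\<forall>x\<le>N'. h x < 0\<close> by (meson linear not_less_iff_gr_or_eq)
    moreover have "x \<le> N" if "h x \<le> 0" for x
      using that \<open>\<forall>x\<ge>N. 0 < h x\<close> by (meson linear not_less)
    ultimately have "{..0} - {x. h x \<le> 0} \<subseteq> {N'..0}" "{x. h x \<le> 0} - {..0} \<subseteq> {0..N}"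
      by (simp_all add: subset_iff not_le)
    then show ?thesis
      unfolding commensurate_def by (meson finite_atLeastAtMost_int finite_subset)
  qed
  interpret neg: int_lipschitz_bijection "\<lambda>x. - f x" "\<lambda>y. g (- y)" L M
    by (rule uminus_image)
  interpret refl: int_lipschitz_bijection "\<lambda>x. - f (- x)" "\<lambda>y. - g (- y)" L M
    by (rule reflect)
  have left: "(\<exists>N. \<forall>x\<le>N. f x < 0) \<or> (\<exists>N. \<forall>x\<le>N. 0 < f x)"
    using refl.eventually_constant_sign
    by (metis add.inverse_inverse le_minus_iff neg_0_less_iff_less neg_less_0_iff_less)
  consider (pp) N N' where "\<forall>x\<ge>N. 0 < f x" "\<forall>x\<le>N'. 0 < f x"
    | (pm) N N' where "\<forall>x\<ge>N. 0 < f x" "\<forall>x\<le>N'. f x < 0"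
    | (mp) N N' where "\<forall>x\<ge>N. f x < 0" "\<forall>x\<le>N'. 0 < f x"
    | (mm) N N' where "\<forall>x\<ge>N. f x < 0" "\<forall>x\<le>N'. f x < 0"
    using left eventually_constant_sign by metis
  then show ?thesis
  proof cases
    case pp
    then show ?thesis
      using not_positive_at_both_ends by blast
  next
    case pm
    then show ?thesis
      using fixes_ends by blast
  next
    case mp
    then show ?thesis
      using fixes_ends[of N "\<lambda>x. - f x" N'] by simp
  next
    case mm
    then show ?thesis
      using neg.not_positive_at_both_ends[of N N'] by simp
  qed
qed

section \<open>How far a point can overshoot a balanced threshold\<close>

text \<open>
  The set \<open>{..m}\<close> is mapped by \<open>g\<close> to the complement of a window around \<open>n\<close>, with \<open>x\<^sub>0\<close> as a
  value on the right of it.  If no step of \<open>g\<close> could span the window, all of \<open>{..f x\<^sub>0}\<close> would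
  end up on the right, against finiteness of the set of crossing points.
\<close>
lemma overshoot_bound:
  assumes above: "m < f n"
    and crossing: "n < x\<^sub>0" "f x\<^sub>0 \<le> m"
    and fin: "finite {x. n < x \<and> f x \<le> m}"
  shows "2 * (f n - m) \<le> L * M"
proof -
  \<comment> \<open>the largest radius \<open>w\<close> with \<open>L * w < f n - m\<close>\<close>
  define w where "w = (f n - m - 1) div L"
  have w: "0 \<le> w" "L * w \<le> f n - m - 1" "f n - m \<le> L * (w + 1)"
  proof -
    show "0 \<le> w"
      unfolding w_def using above L_pos by (simp add: pos_imp_zdiv_nonneg_iff)
    have "f n - m - 1 = L * w + (f n - m - 1) mod L"
      unfolding w_def by simp
    moreover have "0 \<le> (f n - m - 1) mod L" "(f n - m - 1) mod L < L"
      using L_pos by simp_all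
    ultimately show "L * w \<le> f n - m - 1" "f n - m \<le> L * (w + 1)"
      by (simp_all add: distrib_left)
  qed
  have window: "m < f x" if "\<bar>x - n\<bar> \<le> w" for x
  proof -
    have "\<bar>f x - f n\<bar> \<le> L * w"
      using dist_le_of_step_le[of f L x n, OF step_f] mult_left_mono[OF that, of L] L_pos
      by linarith
    then show ?thesis
      using w(2) by linarith
  qed
  have gap: "g y \<le> n - w - 1 \<or> n + w + 1 \<le> g y" if "y \<le> m" for y
    using window[of "g y"] that by force
  have "2 * w + 2 \<le> M"
  proof (rule ccontr)
    assume "\<not> 2 * w + 2 \<le> M"
    \<comment> \<open>then \<open>g\<close> never gets across the window on its way down from \<open>f x\<^sub>0\<close>\<close>
    have right: "n + w + 1 \<le> g (- t)" if "- f x\<^sub>0 \<le> t" for t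
    proof (rule stays_above_gap[where h = "\<lambda>t. g (- t)" and a = "n - w - 1" and s = "- f x\<^sub>0",
          OF _ _ _ _ that])
      show "\<bar>g (- (t + 1)) - g (- t)\<bar> \<le> M" for t
        using step_g[of "- t - 1"] by (simp add: abs_minus_commute)
      show "g (- t) \<le> n - w - 1 \<or> n + w + 1 \<le> g (- t)" if "- f x\<^sub>0 \<le> t" for t
        using gap[of "- t"] that crossing(2) by linarith
      show "M < n + w + 1 - (n - w - 1)"
        using \<open>\<not> 2 * w + 2 \<le> M\<close> by linarith
      show "n + w + 1 \<le> g (- (- f x\<^sub>0))"
        using gap[of "f x\<^sub>0"] crossing w(1) by simp
    qed
    have "g ` {..f x\<^sub>0} \<subseteq> {x. n < x \<and> f x \<le> m}"
    proof (rule image_subsetI)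
      fix y assume "y \<in> {..f x\<^sub>0}"
      then show "g y \<in> {x. n < x \<and> f x \<le> m}"
        using right[of "- y"] w(1) crossing(2) by simp
    qed
    then have "finite (g ` {..f x\<^sub>0})"
      using fin by (rule finite_subset)
    then show False
      using finite_imageD[OF _ inj_on_subset[OF inj_g subset_UNIV]] infinite_Iic by blast
  qed
  then have "L * (2 * w + 2) \<le> L * M"
    using L_pos by simp
  then show ?thesis
    using w(3) by (simp add: algebra_simps)
qed

lemma undershoot_bound:
  assumes below: "f n < m"
    and crossing: "x\<^sub>0 < n" "m \<le> f x\<^sub>0"
    and fin: "finite {x. x < n \<and> m \<le> f x}"
  shows "2 * (m - f n) \<le> L * M"
proof -
  interpret refl: int_lipschitz_bijection "\<lambda>x. - f (- x)" "\<lambda>y. - g (- y)" L M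
    by (rule reflect)
  have "{x. - n < x \<and> - f (- x) \<le> - m} = uminus ` {x. x < n \<and> m \<le> f x}"
    by (force simp: image_iff intro: exI[of _ "- x" for x])
  then have "finite {x. - n < x \<and> - f (- x) \<le> - m}"
    using fin by simp
  then show ?thesis
    using refl.overshoot_bound[of "- m" "- n" "- x\<^sub>0"] assms by simp
qed

section \<open>Bijections that fix the ends are close to translations\<close>

lemma excess_half_lines:
  assumes "commensurate {..0} {x. f x \<le> 0}"
  shows "commensurate {..n} {x. f x \<le> m}"
    and "excess {..n} {x. f x \<le> m} = excess {..0} {x. f x \<le> 0} + n - m"
proof -
  define P where "P n m \<longleftrightarrow> commensurate {..n} {x. f x \<le> m} \<and>
    excess {..n} {x. f x \<le> m} = excess {..0} {x. f x \<le> 0} + n - m" for n m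
  have domain_step: "P (n + 1) m \<longleftrightarrow> P n m" for n m
  proof -
    have "{..n + 1} = insert (n + 1) {..n}"
      by auto
    then show ?thesis
      unfolding P_def using excess_insert_left[of "{..n}" "{x. f x \<le> m}" "n + 1"]
      by (auto simp: commensurate_insert_left)
  qed
  have range_step: "P n (m + 1) \<longleftrightarrow> P n m" for n m
  proof -
    have "x = g (m + 1)" if "f x = m + 1" for x
      using g_f[of x] that by simp
    then have "{x. f x \<le> m + 1} = insert (g (m + 1)) {x. f x \<le> m}"
      by (auto simp: order_le_less zless_add1_eq)
    then show ?thesis
      unfolding P_def using excess_insert_right[of "{..n}" "{x. f x \<le> m}" "g (m + 1)"]
      by (auto simp: commensurate_insert_right)
  qed
  have "P 0 0"
    using assms by (simp add: P_def)
  then have "P n 0"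
  proof (induction n rule: int_induct[where k = 0])
    case (step2 i)
    then show ?case using domain_step[of "i - 1" 0] by simp
  qed (simp_all add: domain_step)
  then have "P n m"
  proof (induction m rule: int_induct[where k = 0])
    case (step2 i)
    then show ?case using range_step[of n "i - 1"] by simp
  qed (simp_all add: range_step)
  then show "commensurate {..n} {x. f x \<le> m}"
    and "excess {..n} {x. f x \<le> m} = excess {..0} {x. f x \<le> 0} + n - m"
    by (simp_all add: P_def)
qed

text \<open>
  When a point lies above its threshold \<open>n + c\<close>, balance of \<open>{..n}\<close> and \<open>{x. f x \<le> n + c}\<close>
  supplies the crossing point in the opposite direction; when it lies below, the same
  is done with both thresholds lowered by one, so that \<open>n\<close> itself is on the right.
\<close>
lemma close_to_translation:
  assumes "commensurate {..0} {x. f x \<le> 0}"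
  shows "2 * \<bar>f n - n - excess {..0} {x. f x \<le> 0}\<bar> \<le> L * M"
proof -
  define c where "c = excess {..0} {x. f x \<le> 0}"
  have fin: "finite ({..k} - {x. f x \<le> k + c})" "finite ({x. f x \<le> k + c} - {..k})"
    and balance: "card ({..k} - {x. f x \<le> k + c}) = card ({x. f x \<le> k + c} - {..k})" for k
    using excess_half_lines[OF assms, of k "k + c"]
    by (simp_all add: commensurate_def excess_def c_def)
  consider "f n = n + c" | "n + c < f n" | "f n < n + c"
    by linarith
  then have "2 * \<bar>f n - n - c\<bar> \<le> L * M"
  proof cases
    case 1
    have "0 \<le> M"
      using step_g[of 0] by linarith
    then show ?thesis
      using 1 L_pos by simp
  next
    case 2
    then have "n \<in> {..n} - {x. f x \<le> n + c}"
      by simp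
    then have "{x. f x \<le> n + c} - {..n} \<noteq> {}"
      using fin[of n] balance[of n] by (metis card_0_eq empty_iff)
    then obtain x\<^sub>0 where "n < x\<^sub>0" "f x\<^sub>0 \<le> n + c"
      by force
    moreover have "{x. n < x \<and> f x \<le> n + c} = {x. f x \<le> n + c} - {..n}"
      by auto
    ultimately have "2 * (f n - (n + c)) \<le> L * M"
      using overshoot_bound[of "n + c" n x\<^sub>0] 2 fin(2)[of n] by simp
    then show ?thesis
      using 2 by simp
  next
    case 3
    then have "n \<in> {x. f x \<le> (n - 1) + c} - {..n - 1}"
      by simp
    then have "{..n - 1} - {x. f x \<le> (n - 1) + c} \<noteq> {}"
      using fin[of "n - 1"] balance[of "n - 1"] by (metis card_0_eq empty_iff)
    then obtain x\<^sub>0 where "x\<^sub>0 < n" "n + c \<le> f x\<^sub>0"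
      by force
    moreover have "{x. x < n \<and> n + c \<le> f x} = {..n - 1} - {x. f x \<le> (n - 1) + c}"
      by auto
    ultimately have "2 * (n + c - f n) \<le> L * M"
      using undershoot_bound[of n "n + c" x\<^sub>0] 3 fin(1)[of "n - 1"] by simp
    then show ?thesis
      using 3 by simp
  qed
  then show ?thesis
    by (simp add: c_def)
qed

lemma close_to_isometry:
  "\<exists>s\<in>{1, - 1}. \<exists>c. \<forall>x. 2 * \<bar>f x - s * x - c\<bar> \<le> L * M"
  using commensurate_up_to_sign
proof
  assume "commensurate {..0} {x. f x \<le> 0}"
  from close_to_translation[OF this] show ?thesis
    by (intro bexI[of _ 1] exI[of _ "excess {..0} {x. f x \<le> 0}"]) auto
next
  interpret neg: int_lipschitz_bijection "\<lambda>x. - f x" "\<lambda>y. g (- y)" L M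
    by (rule uminus_image)
  define c where "c = excess {..0} {x. - f x \<le> 0}"
  assume "commensurate {..0} {x. - f x \<le> 0}"
  from neg.close_to_translation[OF this] have "2 * \<bar>- f x - x - c\<bar> \<le> L * M" for x
    by (simp only: c_def)
  moreover have "\<bar>f x - - 1 * x - - c\<bar> = \<bar>- f x - x - c\<bar>" for x
    by linarith
  ultimately show ?thesis
    by (intro bexI[of _ "- 1"] exI[of _ "- c"]) auto
qed

end

section \<open>Lipschitz constants\<close>

lemma lipschitz_const_le:
  assumes "\<And>x y. x \<in> mspace m1 \<Longrightarrow> y \<in> mspace m1 \<Longrightarrow> mdist m2 (f x) (f y) \<le> C * mdist m1 x y"
  shows "lipschitz_const m1 m2 f \<le> ennreal C"
  unfolding lipschitz_const_def
proof (rule SUP_least, clarify)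
  fix x y assume "x \<in> mspace m1" "y \<in> mspace m1" "x \<noteq> y"
  then have "mdist m2 (f x) (f y) / mdist m1 x y \<le> C"
    using assms mdist_nonneg[of m1 x y] mdist_zero[of x m1 y]
    by (subst pos_divide_le_eq) (simp_all add: less_le)
  then show "ennreal (mdist m2 (f x) (f y) / mdist m1 x y) \<le> ennreal C"
    by (rule ennreal_leI)
qed

text \<open>Differences of consecutive values are integers, so that the constant may be rounded down.\<close>
lemma step_le_floor_lipschitz_const:
  assumes "lipschitz_const int_metric int_metric f \<noteq> \<infinity>"
  shows "\<bar>f (x + 1) - f x\<bar> \<le> \<lfloor>enn2real (lipschitz_const int_metric int_metric f)\<rfloor>"
proof -
  have "ennreal (mdist int_metric (f (x + 1)) (f x) / mdist int_metric (x + 1) x)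
      \<le> lipschitz_const int_metric int_metric f"
    unfolding lipschitz_const_def by (rule SUP_upper2[of "(x + 1, x)"]) auto
  then have "ennreal (real_of_int \<bar>f (x + 1) - f x\<bar>) \<le> lipschitz_const int_metric int_metric f"
    by simp
  then have "real_of_int \<bar>f (x + 1) - f x\<bar> \<le> enn2real (lipschitz_const int_metric int_metric f)"
    using enn2real_mono[of "ennreal (real_of_int \<bar>f (x + 1) - f x\<bar>)"] assms
    by (simp add: top.not_eq_extremum)
  then show ?thesis
    by (simp only: le_floor_iff)
qed

lemma lipschitz_const_finite:
  assumes "bi_lipschitz_bijection m1 m2 f"
  shows "lipschitz_const m1 m2 f \<noteq> \<infinity>"
  using assms lipschitz_const_le unfolding bi_lipschitz_bijection_def
  by (metis ennreal_less_top infinity_ennreal_def leD)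

lemma lipschitz_const_inv_finite:
  assumes "bi_lipschitz_bijection m1 m2 f" "mspace m1 = UNIV" "mspace m2 = UNIV"
  shows "lipschitz_const m2 m1 (inv f) \<noteq> \<infinity>"
proof -
  obtain C where "0 < C" and C: "\<And>x y. C * mdist m1 x y \<le> mdist m2 (f x) (f y)"
    using assms unfolding bi_lipschitz_bijection_def by auto
  have "surj f"
    using assms by (auto simp: bi_lipschitz_bijection_def bij_betw_def)
  then have "mdist m1 (inv f x) (inv f y) \<le> (1 / C) * mdist m2 x y" for x y
    using C[of "inv f x" "inv f y"] \<open>0 < C\<close> by (simp add: surj_f_inv_f field_simps)
  then have "lipschitz_const m2 m1 (inv f) \<le> ennreal (1 / C)"
    by (intro lipschitz_const_le)
  then show ?thesis
    by (metis ennreal_less_top infinity_ennreal_def leD)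
qed

lemma SUP_ennreal_abs_less_top:
  fixes h :: "int \<Rightarrow> int"
  assumes "\<And>x. \<bar>h x\<bar> \<le> B"
  shows "(SUP x. ennreal (real_of_int \<bar>h x\<bar>)) < \<infinity>"
proof -
  have "(SUP x. ennreal (real_of_int \<bar>h x\<bar>)) \<le> ennreal (real_of_int B)"
    using assms by (intro SUP_least ennreal_leI) (simp only: of_int_le_iff)
  then show ?thesis
    using ennreal_less_top infinity_ennreal_def le_less_trans by metis
qed

theorem theorem1:
  fixes f :: "int \<Rightarrow> int"
  assumes "bi_lipschitz_bijection int_metric int_metric f"
  shows "((SUP x. ennreal (real_of_int \<bar>f x - x\<bar>)) < \<infinity> \<or>
          (SUP x. ennreal (real_of_int \<bar>f x + x\<bar>)) < \<infinity>) \<and>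
         (\<exists>\<epsilon>\<in>{1, -1::real}. \<exists>c::real. \<exists>r::int \<Rightarrow> real. \<forall>x.
            real_of_int (f x) = \<epsilon> * real_of_int x + c + r x \<and>
            ennreal \<bar>r x\<bar> \<le> lipschitz_const int_metric int_metric f *
                            lipschitz_const int_metric int_metric (inv f))"
proof -
  define \<Lambda> where "\<Lambda> = lipschitz_const int_metric int_metric f"
  define \<Lambda>' where "\<Lambda>' = lipschitz_const int_metric int_metric (inv f)"
  have finite_consts: "\<Lambda> \<noteq> \<infinity>" "\<Lambda>' \<noteq> \<infinity>"
    unfolding \<Lambda>_def \<Lambda>'_def
    using lipschitz_const_finite[OF assms] lipschitz_const_inv_finite[OF assms]
    by simp_all
  define L where "L = \<lfloor>enn2real \<Lambda>\<rfloor>"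
  define M where "M = \<lfloor>enn2real \<Lambda>'\<rfloor>"
  have "bij f"
    using assms by (simp add: bi_lipschitz_bijection_def)
  interpret int_lipschitz_bijection f "inv f" L M
  proof
    show "\<bar>f (x + 1) - f x\<bar> \<le> L" for x
      using step_le_floor_lipschitz_const finite_consts by (simp add: L_def \<Lambda>_def)
    show "\<bar>inv f (y + 1) - inv f y\<bar> \<le> M" for y
      using step_le_floor_lipschitz_const finite_consts by (simp add: M_def \<Lambda>'_def)
  qed (use \<open>bij f\<close> in \<open>simp_all add: bij_is_inj bij_is_surj surj_f_inv_f\<close>)
  obtain s c where s: "s \<in> {1, - 1}" and close: "\<And>x. 2 * \<bar>f x - s * x - c\<bar> \<le> L * M"
    using close_to_isometry by blast
  have close': "\<bar>f x - s * x - c\<bar> \<le> L * M" for x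
    by (rule order_trans[OF _ close[of x]]) (simp only: mult_2 le_add_same_cancel1 abs_ge_zero)
  have "\<bar>f x - s * x\<bar> \<le> \<bar>c\<bar> + L * M" for x
    using close'[of x] by linarith
  then have "(SUP x. ennreal (real_of_int \<bar>f x - s * x\<bar>)) < \<infinity>"
    by (rule SUP_ennreal_abs_less_top)
  then have bounded: "(SUP x. ennreal (real_of_int \<bar>f x - x\<bar>)) < \<infinity> \<or>
      (SUP x. ennreal (real_of_int \<bar>f x + x\<bar>)) < \<infinity>"
    using s by auto
  have "0 \<le> M"
    unfolding M_def by simp
  then have "real_of_int (L * M) \<le> enn2real \<Lambda> * enn2real \<Lambda>'"
    by (simp add: L_def M_def mult_mono)
  then have "ennreal (real_of_int (L * M)) \<le> ennreal (enn2real \<Lambda> * enn2real \<Lambda>')"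
    by (rule ennreal_leI)
  also have "\<dots> = \<Lambda> * \<Lambda>'"
    using finite_consts by (simp add: ennreal_mult ennreal_enn2real_if)
  finally have LM: "ennreal (real_of_int (L * M)) \<le> \<Lambda> * \<Lambda>'" .
  have "ennreal \<bar>real_of_int (f x - s * x - c)\<bar> \<le> \<Lambda> * \<Lambda>'" for x
  proof -
    have "\<bar>real_of_int (f x - s * x - c)\<bar> \<le> real_of_int (L * M)"
      using close'[of x] by (simp only: of_int_abs[symmetric] of_int_le_iff)
    then show ?thesis
      using LM ennreal_leI order_trans by blast
  qed
  then have "\<forall>x. real_of_int (f x) = real_of_int s * real_of_int x + real_of_int c
        + real_of_int (f x - s * x - c) \<and>
      ennreal \<bar>real_of_int (f x - s * x - c)\<bar> \<le> \<Lambda> * \<Lambda>'"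
    by simp
  moreover have "real_of_int s \<in> {1, - 1}"
    using s by auto
  ultimately show ?thesis
    using bounded unfolding \<Lambda>_def \<Lambda>'_def
    by (intro conjI bexI[of _ "real_of_int s"] exI[of _ "real_of_int c"]
        exI[of _ "\<lambda>x. real_of_int (f x - s * x - c)"]) simp_all
qed

end
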